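(* Let $P$ be a linear lasso program over $K^n$ given in the normal form below, let $T$ be a linear ranking function template written in conjunctive normal form as below, let $L$ be a finite index set with strictness symbols $\rhd_\ell\in\{\ge,>\}$ for $\ell\in L$, and let $(\mathrm{II5})\wedge(\mathrm{IC5})\wedge(\mathrm{TI5})$ be the constraint constructed below. If $(\mathrm{II5})\wedge(\mathrm{IC5})\wedge(\mathrm{TI5})$ is satisfiable, then $P$ terminates.
   Context: $K$ is $\mathbb{Q}$ or a real closed field; vectors are column vectors, $v^T$ is the transpose, $(x;x')\in K^{2n}$ is the stacked vector, vector inequalities are componentwise. A lasso program over $K^n$ is a pair $P=(\mathrm{stem},\mathrm{loop})$, $\mathrm{stem}\subseteq K^n$, $\mathrm{loop}\subseteq K^n\times K^n$; an execution is a finite or infinite sequence $\sigma_0\sigma_1\ldots$ with $\sigma_0\in\mathrm{stem}$ and $(\sigma_i,\sigma_{i+1})\in\mathrm{loop}$ for all $i$; $P$ terminates iff it has no infinite execution. $P$ is linear and given in normal form: $\mathrm{stem}(x)\equiv\bigvee_{\nu\in N}(B_\nu x\le b_\nu\wedge B'_\nu x<b'_\nu)$ and $\mathrm{loop}(x,x')\equiv\bigvee_{m\in M}(A_m(x;x')\le c_m\wedge A'_m(x;x')<c'_m)$ with finite index sets $N,M$ and constant matrices and vectors over $K$. Templates: a template is a quantifier-free formula $T(x,x')$ that additionally contains a finite set $D$ of unknown scalars and a finite set $F$ of affine-linear function symbols, each $f\in F$ standing for $x\mapsto s_f^Tx+t_f$ with unknowns $s_f\in K^n,t_f\in K$. $T$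 is a ranking function template iff for every lasso program $Q$ over $K^n$, if some assignment to the unknowns makes $\forall\sigma,\sigma'.\ (\sigma,\sigma')\in\mathrm{loop}_Q\to T(\sigma,\sigma')$ true, then $Q$ terminates. It is a linear ranking function template if moreover it is a boolean combination of atoms $\sum_{f\in F}(\alpha_f f(x)+\beta_f f(x'))+\sum_{d\in D}\gamma_d d\rhd 0$ with constants $\alpha_f,\beta_f,\gamma_d\in K$, $\rhd\in\{\ge,>\}$. Here $T\equiv\bigwedge_{i\in I}\bigvee_{j\in J_i}T_{i,j}(x,x')$ (CNF, finite index sets), and each atom occurrence $T_{i,j}$, being $\sum_f(\alpha_f f(x)+\beta_f f(x'))+\sum_d\gamma_d d\rhd_{i,j}0$, is written as $d_{i,j}^T(x;x')\rhd_{i,j}e_{i,j}$ with $d_{i,j}=(\sum_f\alpha_f s_f;\sum_f\beta_f s_f)$ and $e_{i,j}=-(\sum_f(\alpha_f+\beta_f)t_f+\sum_d\gamma_d d)$, expressions in the template unknowns. Invariants: let $L'=L\times I\times M$; for each $\ell'=(\ell,i,m)\in L'$ introduce unknowns $s_{\ell'}\in K^n$, $t_{\ell'}\in K$ and the formula $\psi_{\ell'}(x)\equiv s_{\ell'}^Tx+t_{\ell'}\rhd_\ell 0$. Negations of inequalities are read as inequalities: $\neg(a\ge b)$ is $a<b$, $\neg(a>b)$ is $a\le b$. Consider the universally quantified formulas (II4) for each $\ell'\in L'$, $\nu\in N$: $\forall x.\ \neg(B_\nu x\le b_\nu\wedge B'_\nu x<b'_\nu\wedge\neg\psi_{\ell'}(x))$;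 (IC4) for each $\ell'\in L'$, $m\in M$: $\forall x,x'.\ \neg(\psi_{\ell'}(x)\wedge A_m(x;x')\le c_m\wedge A'_m(x;x')<c'_m\wedge\neg\psi_{\ell'}(x'))$; (TI4) for each $i\in I$, $m\in M$: $\forall x,x'.\ \neg\big(A_m(x;x')\le c_m\wedge A'_m(x;x')<c'_m\wedge\bigwedge_{\ell\in L}\psi_{(\ell,i,m)}(x)\wedge\bigwedge_{j\in J_i}\neg T_{i,j}(x,x')\big)$. In each such formula let $z$ be the quantified vector ($x$ or $(x;x')$) and write every conjunct inside $\neg(\ldots)$ (each row of a matrix inequality separately) as a single inequality $p_k^Tz\le q_k$ ($k\in R_\le$) or $p_k^Tz<q_k$ ($k\in R_<$) by collecting $z$-terms on the left and the rest on the right, without rescaling; entries of $p_k,q_k$ are constants or expressions in the unknowns. Its Motzkin transform is $\exists(\kappa_k)_{k\in R_\le\cup R_<}\ge0.\ \sum_k\kappa_kp_k=0\wedge\sum_k\kappa_kq_k\le0\wedge(\sum_{k\in R_\le}\kappa_kq_k<0\vee\sum_{k\in R_<}\kappa_k>0)$; $\kappa_k$ is the Motzkin coefficient of the $k$-th inequality. (II5), (IC5), (TI5) are the conjunctions of the Motzkin transforms (each with its own fresh coefficients) of all formulas in (II4), (IC4), (TI4) respectively. The constraint is satisfiable iff there are values in $K$ for all unknowns ($s_{\ell'},t_{\ell'}$, all $s_f,t_f$ for $f\in F$, all $d\in D$) making it true in $K$. *)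

theory Defs
  imports
    "HOL-Computational_Algebra.Polynomial"
    "Jordan_Normal_Form.Matrix"
begin

section \<open>The ground field\<close>

definition real_closed :: "'k::linordered_field itself \<Rightarrow> bool" where
  "real_closed _ \<longleftrightarrow>
     (\<forall>a::'k. a \<ge> 0 \<longrightarrow> (\<exists>b. b\<^sup>2 = a)) \<and>
     (\<forall>p::'k poly. odd (degree p) \<longrightarrow> (\<exists>x. poly p x = 0))"

text \<open>An ordered field all of whose elements are rational is (uniquely isomorphic to) the field of
  rational numbers.\<close>

definition rational_or_real_closed :: "'k::linordered_field itself \<Rightarrow> bool" where
  "rational_or_real_closed K \<longleftrightarrow> (\<rat> :: 'k set) = UNIV \<or> real_closed K"

section \<open>Lasso programs\<close>

type_synonym 'k lasso = "'k vec set \<times> ('k vec \<times> 'k vec) set"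

definition lasso_program :: "nat \<Rightarrow> 'k lasso \<Rightarrow> bool" where
  "lasso_program n P \<longleftrightarrow>
     fst P \<subseteq> carrier_vec n \<and> snd P \<subseteq> carrier_vec n \<times> carrier_vec n"

definition infinite_execution :: "'k lasso \<Rightarrow> (nat \<Rightarrow> 'k vec) \<Rightarrow> bool" where
  "infinite_execution P \<sigma> \<longleftrightarrow> \<sigma> 0 \<in> fst P \<and> (\<forall>i. (\<sigma> i, \<sigma> (Suc i)) \<in> snd P)"

definition terminates :: "'k lasso \<Rightarrow> bool" where
  "terminates P \<longleftrightarrow> \<not> (\<exists>\<sigma>. infinite_execution P \<sigma>)"

text \<open>The strict order that the library puts on vectors is not the componentwise one
  (it is \<open>v \<le> w \<and> \<not> w \<le> v\<close>), whereas its \<open>\<le>\<close> is componentwise.\<close>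

definition vec_less :: "'k::ord vec \<Rightarrow> 'k vec \<Rightarrow> bool" (infix \<open>\<prec>\<^sub>v\<close> 50) where
  "v \<prec>\<^sub>v w \<longleftrightarrow> dim_vec v = dim_vec w \<and> (\<forall>i < dim_vec w. v $ i < w $ i)"

definition polyhedron ::
  "nat \<Rightarrow> 'k::linordered_field mat \<Rightarrow> 'k vec \<Rightarrow> 'k mat \<Rightarrow> 'k vec \<Rightarrow> 'k vec set" where
  "polyhedron d C c C' c' = {z \<in> carrier_vec d. C *\<^sub>v z \<le> c \<and> C' *\<^sub>v z \<prec>\<^sub>v c'}"

definition linear_lasso ::
  "nat \<Rightarrow>
   'nu set \<Rightarrow> ('nu \<Rightarrow> 'k::linordered_field mat) \<Rightarrow> ('nu \<Rightarrow> 'k vec) \<Rightarrow>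
     ('nu \<Rightarrow> 'k mat) \<Rightarrow> ('nu \<Rightarrow> 'k vec) \<Rightarrow>
   'm set \<Rightarrow> ('m \<Rightarrow> 'k mat) \<Rightarrow> ('m \<Rightarrow> 'k vec) \<Rightarrow> ('m \<Rightarrow> 'k mat) \<Rightarrow> ('m \<Rightarrow> 'k vec) \<Rightarrow>
   'k lasso" where
  "linear_lasso n N B b B' b' M A c A' c' =
     ({x \<in> carrier_vec n. \<exists>\<nu>\<in>N. x \<in> polyhedron n (B \<nu>) (b \<nu>) (B' \<nu>) (b' \<nu>)},
      {(x, x'). x \<in> carrier_vec n \<and> x' \<in> carrier_vec n \<and>
         (\<exists>m\<in>M. x @\<^sub>v x' \<in> polyhedron (n + n) (A m) (c m) (A' m) (c' m))})"

section \<open>Ranking function templates\<close>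

datatype strictness = Ge | Gt

fun rel_holds :: "strictness \<Rightarrow> 'k::linorder \<Rightarrow> 'k \<Rightarrow> bool" where
  "rel_holds Ge a b \<longleftrightarrow> a \<ge> b"
| "rel_holds Gt a b \<longleftrightarrow> a > b"

text \<open>A template is represented by its truth value as a function of the values \<open>s\<close>, \<open>t\<close>
  of the coefficients of the affine-linear function symbols in \<open>F\<close>, of the values \<open>u\<close> of the scalar
  unknowns, and of the states \<open>x\<close> and \<open>x'\<close>.\<close>

type_synonym ('f, 'd, 'k) template =
  "('f \<Rightarrow> 'k vec) \<Rightarrow> ('f \<Rightarrow> 'k) \<Rightarrow> ('d \<Rightarrow> 'k) \<Rightarrow> 'k vec \<Rightarrow> 'k vec \<Rightarrow> bool"

definition ranking_function_template :: "nat \<Rightarrow> 'f set \<Rightarrow> ('f, 'd, 'k) template \<Rightarrow> bool" where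
  "ranking_function_template n F T \<longleftrightarrow>
     (\<forall>Q. lasso_program n Q \<longrightarrow>
        (\<exists>s t u. (\<forall>f\<in>F. s f \<in> carrier_vec n) \<and>
           (\<forall>\<sigma> \<sigma>'. (\<sigma>, \<sigma>') \<in> snd Q \<longrightarrow> T s t u \<sigma> \<sigma>')) \<longrightarrow>
        terminates Q)"

record ('f, 'd, 'k) linear_atom =
  \<alpha> :: "'f \<Rightarrow> 'k"
  \<beta> :: "'f \<Rightarrow> 'k"
  \<gamma> :: "'d \<Rightarrow> 'k"
  rel :: strictness

definition atom_holds ::
  "'f set \<Rightarrow> 'd set \<Rightarrow> ('f, 'd, 'k::linordered_field) linear_atom \<Rightarrow> ('f, 'd, 'k) template" where
  "atom_holds F D a s t u x x' \<longleftrightarrow>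
     rel_holds (rel a)
       ((\<Sum>f\<in>F. \<alpha> a f * (s f \<bullet> x + t f) + \<beta> a f * (s f \<bullet> x' + t f)) + (\<Sum>d\<in>D. \<gamma> a d * u d)) 0"

definition cnf_template ::
  "'f set \<Rightarrow> 'd set \<Rightarrow> 'i set \<Rightarrow> ('i \<Rightarrow> 'j set) \<Rightarrow>
   ('i \<Rightarrow> 'j \<Rightarrow> ('f, 'd, 'k::linordered_field) linear_atom) \<Rightarrow> ('f, 'd, 'k) template" where
  "cnf_template F D I J T s t u x x' \<longleftrightarrow>
     (\<forall>i\<in>I. \<exists>j\<in>J i. atom_holds F D (T i j) s t u x x')"

text \<open>The atom, rewritten as \<open>atom_vec\<^sup>T (x; x') \<rhd> atom_rhs\<close>.\<close>

definition atom_vec ::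
  "nat \<Rightarrow> 'f set \<Rightarrow> ('f, 'd, 'k::linordered_field) linear_atom \<Rightarrow> ('f \<Rightarrow> 'k vec) \<Rightarrow> 'k vec" where
  "atom_vec n F a s =
     finsum_vec TYPE('k) n (\<lambda>f. \<alpha> a f \<cdot>\<^sub>v s f) F @\<^sub>v finsum_vec TYPE('k) n (\<lambda>f. \<beta> a f \<cdot>\<^sub>v s f) F"

definition atom_rhs ::
  "'f set \<Rightarrow> 'd set \<Rightarrow> ('f, 'd, 'k::linordered_field) linear_atom \<Rightarrow>
   ('f \<Rightarrow> 'k) \<Rightarrow> ('d \<Rightarrow> 'k) \<Rightarrow> 'k" where
  "atom_rhs F D a t u = - ((\<Sum>f\<in>F. (\<alpha> a f + \<beta> a f) * t f) + (\<Sum>d\<in>D. \<gamma> a d * u d))"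

section \<open>Motzkin transforms\<close>

text \<open>\<open>LE p q\<close> stands for \<open>p\<^sup>T z \<le> q\<close> and \<open>LT p q\<close> for \<open>p\<^sup>T z < q\<close>.\<close>

datatype 'k ineq =
    is_LE: LE (lhs: "'k vec") (rhs: 'k)
  | is_LT: LT (lhs: "'k vec") (rhs: 'k)

text \<open>\<open>pos_ineq r p e\<close> is \<open>p\<^sup>T z \<rhd> e\<close> and \<open>neg_ineq r p e\<close> is its negation, where \<open>\<rhd>\<close> is given by \<open>r\<close>.\<close>

fun pos_ineq :: "strictness \<Rightarrow> 'k::linordered_field vec \<Rightarrow> 'k \<Rightarrow> 'k ineq" where
  "pos_ineq Ge p e = LE (- p) (- e)"
| "pos_ineq Gt p e = LT (- p) (- e)"

fun neg_ineq :: "strictness \<Rightarrow> 'k::linordered_field vec \<Rightarrow> 'k \<Rightarrow> 'k ineq" where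
  "neg_ineq Ge p e = LT p e"
| "neg_ineq Gt p e = LE p e"

definition motzkin_transform ::
  "nat \<Rightarrow> 'r set \<Rightarrow> ('r \<Rightarrow> 'k::linordered_field ineq) \<Rightarrow> bool" where
  "motzkin_transform d R c \<longleftrightarrow>
     (\<exists>\<kappa> :: 'r \<Rightarrow> 'k.
        (\<forall>k\<in>R. \<kappa> k \<ge> 0) \<and>
        finsum_vec TYPE('k) d (\<lambda>k. \<kappa> k \<cdot>\<^sub>v lhs (c k)) R = 0\<^sub>v d \<and>
        (\<Sum>k\<in>R. \<kappa> k * rhs (c k)) \<le> 0 \<and>
        ((\<Sum>k\<in>{k\<in>R. is_LE (c k)}. \<kappa> k * rhs (c k)) < 0 \<or>
         (\<Sum>k\<in>{k\<in>R. is_LT (c k)}. \<kappa> k) > 0))"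

text \<open>All formulas to be transformed have the shape
  \<open>\<forall>z. \<not> (C z \<le> c \<and> C' z < c' \<and> (\<And>a\<in>H. h a) \<and> (\<And>b\<in>G. g b))\<close>.
  The labels make sure that each conjunct, and each matrix row, has a Motzkin
  coefficient of its own, even if two conjuncts happen to coincide.\<close>

datatype ('h, 'g) conjunct = LeRow nat | LtRow nat | Hyp 'h | NegConcl 'g

definition conjuncts ::
  "'k mat \<Rightarrow> 'k mat \<Rightarrow> 'h set \<Rightarrow> 'g set \<Rightarrow> ('h, 'g) conjunct set" where
  "conjuncts C C' H G =
     LeRow ` {..<dim_row C} \<union> LtRow ` {..<dim_row C'} \<union> Hyp ` H \<union> NegConcl ` G"

fun conjunct_ineq ::
  "'k mat \<Rightarrow> 'k vec \<Rightarrow> 'k mat \<Rightarrow> 'k vec \<Rightarrow> ('h \<Rightarrow> 'k ineq) \<Rightarrow> ('g \<Rightarrow> 'k ineq) \<Rightarrow>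
   ('h, 'g) conjunct \<Rightarrow> 'k ineq" where
  "conjunct_ineq C c C' c' h g (LeRow r) = LE (row C r) (c $ r)"
| "conjunct_ineq C c C' c' h g (LtRow r) = LT (row C' r) (c' $ r)"
| "conjunct_ineq C c C' c' h g (Hyp a) = h a"
| "conjunct_ineq C c C' c' h g (NegConcl b) = g b"

definition motzkin ::
  "nat \<Rightarrow> 'k::linordered_field mat \<Rightarrow> 'k vec \<Rightarrow> 'k mat \<Rightarrow> 'k vec \<Rightarrow>
   'h set \<Rightarrow> ('h \<Rightarrow> 'k ineq) \<Rightarrow> 'g set \<Rightarrow> ('g \<Rightarrow> 'k ineq) \<Rightarrow> bool" where
  "motzkin d C c C' c' H h G g \<longleftrightarrow>
     motzkin_transform d (conjuncts C C' H G) (conjunct_ineq C c C' c' h g)"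

section \<open>The constraint\<close>

text \<open>The invariant \<open>\<psi>\<close> for \<open>l' = (l, i, m)\<close> is \<open>(s l')\<^sup>T x + t l' \<rhd> 0\<close>, that is,
  \<open>(s l')\<^sup>T x \<rhd> - t l'\<close>, with \<open>\<rhd>\<close> given by \<open>rl l\<close>.
  As an inequality in \<open>(x; x')\<close>, its coefficient vector is padded with zeros.\<close>

definition II5 ::
  "nat \<Rightarrow>
   'nu set \<Rightarrow> ('nu \<Rightarrow> 'k::linordered_field mat) \<Rightarrow> ('nu \<Rightarrow> 'k vec) \<Rightarrow>
     ('nu \<Rightarrow> 'k mat) \<Rightarrow> ('nu \<Rightarrow> 'k vec) \<Rightarrow>
   'm set \<Rightarrow> 'i set \<Rightarrow> 'l set \<Rightarrow> ('l \<Rightarrow> strictness) \<Rightarrow>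
   ('l \<times> 'i \<times> 'm \<Rightarrow> 'k vec) \<Rightarrow> ('l \<times> 'i \<times> 'm \<Rightarrow> 'k) \<Rightarrow> bool" where
  "II5 n N B b B' b' M I L rl s t \<longleftrightarrow>
     (\<forall>l'\<in>L \<times> I \<times> M. \<forall>\<nu>\<in>N.
        motzkin n (B \<nu>) (b \<nu>) (B' \<nu>) (b' \<nu>)
          ({} :: unit set) (\<lambda>_. undefined)
          {()} (\<lambda>_. neg_ineq (rl (fst l')) (s l') (- t l')))"

definition IC5 ::
  "nat \<Rightarrow>
   'm set \<Rightarrow> ('m \<Rightarrow> 'k::linordered_field mat) \<Rightarrow> ('m \<Rightarrow> 'k vec) \<Rightarrow>
     ('m \<Rightarrow> 'k mat) \<Rightarrow> ('m \<Rightarrow> 'k vec) \<Rightarrow>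
   'i set \<Rightarrow> 'l set \<Rightarrow> ('l \<Rightarrow> strictness) \<Rightarrow>
   ('l \<times> 'i \<times> 'm \<Rightarrow> 'k vec) \<Rightarrow> ('l \<times> 'i \<times> 'm \<Rightarrow> 'k) \<Rightarrow> bool" where
  "IC5 n M A c A' c' I L rl s t \<longleftrightarrow>
     (\<forall>l'\<in>L \<times> I \<times> M. \<forall>m\<in>M.
        motzkin (n + n) (A m) (c m) (A' m) (c' m)
          {()} (\<lambda>_. pos_ineq (rl (fst l')) (s l' @\<^sub>v 0\<^sub>v n) (- t l'))
          {()} (\<lambda>_. neg_ineq (rl (fst l')) (0\<^sub>v n @\<^sub>v s l') (- t l')))"

definition TI5 ::
  "nat \<Rightarrow>
   'm set \<Rightarrow> ('m \<Rightarrow> 'k::linordered_field mat) \<Rightarrow> ('m \<Rightarrow> 'k vec) \<Rightarrow>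
     ('m \<Rightarrow> 'k mat) \<Rightarrow> ('m \<Rightarrow> 'k vec) \<Rightarrow>
   'f set \<Rightarrow> 'd set \<Rightarrow> 'i set \<Rightarrow> ('i \<Rightarrow> 'j set) \<Rightarrow> ('i \<Rightarrow> 'j \<Rightarrow> ('f, 'd, 'k) linear_atom) \<Rightarrow>
   'l set \<Rightarrow> ('l \<Rightarrow> strictness) \<Rightarrow>
   ('l \<times> 'i \<times> 'm \<Rightarrow> 'k vec) \<Rightarrow> ('l \<times> 'i \<times> 'm \<Rightarrow> 'k) \<Rightarrow>
   ('f \<Rightarrow> 'k vec) \<Rightarrow> ('f \<Rightarrow> 'k) \<Rightarrow> ('d \<Rightarrow> 'k) \<Rightarrow> bool" where
  "TI5 n M A c A' c' F D I J T L rl s t sF tF u \<longleftrightarrow>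
     (\<forall>i\<in>I. \<forall>m\<in>M.
        motzkin (n + n) (A m) (c m) (A' m) (c' m)
          L (\<lambda>l. pos_ineq (rl l) (s (l, i, m) @\<^sub>v 0\<^sub>v n) (- t (l, i, m)))
          (J i) (\<lambda>j. neg_ineq (rel (T i j)) (atom_vec n F (T i j) sF) (atom_rhs F D (T i j) tF u)))"

end

theory Submission
  imports Defs
begin

text \<open>Only the easy direction of Motzkin's transposition theorem is needed: a solution of the
  transformed formula is a certificate of infeasibility, over any ordered field. Hence
  the constraint makes each \<open>\<psi>\<close> an inductive invariant, so it holds along every execution of the
  program, and then \<open>T\<close> holds for all transitions that occur in that execution. These transitions
  alone form a lasso program \<open>Q\<close> (in general not a linear one) whose loop satisfies \<open>T\<close>. Since \<open>T\<close>
  is a ranking function template, \<open>Q\<close> terminates, so the execution is not infinite.\<close>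

text \<open>The transform uses an \<open>ineq\<close> only through its coefficients and strictness.
  This gives it a meaning at a point \<open>z\<close>, so that certificates say something about
  states.\<close>

fun ineq_holds :: "'k::linordered_field vec \<Rightarrow> 'k ineq \<Rightarrow> bool" where
  "ineq_holds z (LE p q) \<longleftrightarrow> p \<bullet> z \<le> q"
| "ineq_holds z (LT p q) \<longleftrightarrow> p \<bullet> z < q"

text \<open>\<open>pos_ineq\<close> negates both sides, and \<open>- p\<close> has specified entries
  only up to the dimension of \<open>p\<close>; the assumption makes
  \<open>(- p) \<bullet> z\<close> equal to \<open>- (p \<bullet> z)\<close>.\<close>

lemma ineq_holds_pos_ineq:
  assumes "dim_vec p = dim_vec z"
  shows "ineq_holds z (pos_ineq r p e) \<longleftrightarrow> rel_holds r (p \<bullet> z) e"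
  using assms by (cases r) auto

lemma ineq_holds_neg_ineq:
  "ineq_holds z (neg_ineq r p e) \<longleftrightarrow> \<not> rel_holds r (p \<bullet> z) e"
  by (cases r) auto

lemma lhs_pos_ineq [simp]: "lhs (pos_ineq r p e) = - p"
  by (cases r) auto

lemma lhs_neg_ineq [simp]: "lhs (neg_ineq r p e) = p"
  by (cases r) auto

lemma rel_holds_add_0: "rel_holds r (a + b) 0 \<longleftrightarrow> rel_holds r a (- b :: 'k::linordered_field)"
  by (cases r) (simp only: rel_holds.simps, linarith)+

lemma finsum_vec_scalar_prod:
  fixes v :: "'r \<Rightarrow> 'k::comm_ring_1 vec"
  assumes "finite R" "v \<in> R \<rightarrow> carrier_vec d" "z \<in> carrier_vec d"
  shows "finsum_vec TYPE('k) d v R \<bullet> z = (\<Sum>k\<in>R. v k \<bullet> z)"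
  using assms(1,2)
proof (induction R)
  case empty
  then show ?case using assms(3) by (simp add: finsum_vec_empty)
next
  case (insert k R)
  then have "v \<in> R \<rightarrow> carrier_vec d" "v k \<in> carrier_vec d" by auto
  with insert assms(3) show ?case
    by (simp add: finsum_vec_insert add_scalar_prod_distrib[of _ d] finsum_vec_closed)
qed

text \<open>At a common solution \<open>z\<close> the weighted slacks
  \<open>\<kappa> k * (rhs (c k) - lhs (c k) \<bullet> z)\<close> are nonnegative, and their sum is
  at most 0 because the combination of left-hand sides vanishes. So every one of them is 0, which
  refutes both alternatives of the certificate.\<close>

lemma motzkin_transform_infeasible:
  fixes c :: "'r \<Rightarrow> 'k::linordered_field ineq"
  assumes "motzkin_transform d R c" "finite R"
    and dim: "\<And>k. k \<in> R \<Longrightarrow> lhs (c k) \<in> carrier_vec d"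
    and z: "z \<in> carrier_vec d"
  shows "\<exists>k\<in>R. \<not> ineq_holds z (c k)"
proof (rule ccontr)
  assume "\<not> (\<exists>k\<in>R. \<not> ineq_holds z (c k))"
  then have holds: "\<And>k. k \<in> R \<Longrightarrow> ineq_holds z (c k)" by blast
  from assms(1) obtain \<kappa> :: "'r \<Rightarrow> 'k" where
    nonneg: "\<And>k. k \<in> R \<Longrightarrow> \<kappa> k \<ge> 0"
    and zero: "finsum_vec TYPE('k) d (\<lambda>k. \<kappa> k \<cdot>\<^sub>v lhs (c k)) R = 0\<^sub>v d"
    and le: "(\<Sum>k\<in>R. \<kappa> k * rhs (c k)) \<le> 0"
    and alt: "(\<Sum>k\<in>{k\<in>R. is_LE (c k)}. \<kappa> k * rhs (c k)) < 0 \<or>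
      (\<Sum>k\<in>{k\<in>R. is_LT (c k)}. \<kappa> k) > 0"
    unfolding motzkin_transform_def by blast
  have "(\<Sum>k\<in>R. \<kappa> k * (lhs (c k) \<bullet> z)) = (\<Sum>k\<in>R. (\<kappa> k \<cdot>\<^sub>v lhs (c k)) \<bullet> z)"
    using dim z by (intro sum.cong) auto
  also have "\<dots> = 0\<^sub>v d \<bullet> z"
    using dim z \<open>finite R\<close> by (subst zero[symmetric], subst finsum_vec_scalar_prod) auto
  finally have sum0: "(\<Sum>k\<in>R. \<kappa> k * (lhs (c k) \<bullet> z)) = 0"
    using z by simp
  have slack: "lhs (c k) \<bullet> z \<le> rhs (c k)" "is_LT (c k) \<Longrightarrow> lhs (c k) \<bullet> z < rhs (c k)"
    if "k \<in> R" for k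
    using holds[OF that] by (cases "c k"; simp)+
  have "\<kappa> k * (rhs (c k) - lhs (c k) \<bullet> z) = 0" if "k \<in> R" for k
  proof -
    have nn: "\<kappa> k * (rhs (c k) - lhs (c k) \<bullet> z) \<ge> 0" if "k \<in> R" for k
      using nonneg slack(1) that by simp
    have "(\<Sum>k\<in>R. \<kappa> k * (rhs (c k) - lhs (c k) \<bullet> z)) \<le> 0"
      using le sum0 by (simp add: right_diff_distrib sum_subtractf)
    then have "(\<Sum>k\<in>R. \<kappa> k * (rhs (c k) - lhs (c k) \<bullet> z)) = 0"
      using sum_nonneg[of R, OF nn] by (simp add: order.antisym)
    from sum_nonneg_0[OF \<open>finite R\<close> _ this that] nn show ?thesis by blast
  qed
  then have tight: "\<kappa> k * rhs (c k) = \<kappa> k * (lhs (c k) \<bullet> z)" if "k \<in> R" for k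
    using that by (simp add: right_diff_distrib)
  \<comment> \<open>A strict inequality has positive slack, so its weighted slack can vanish only
    through the coefficient.\<close>
  have strict0: "\<kappa> k = 0" if "k \<in> R" "is_LT (c k)" for k
    using tight[OF that(1)] slack(2)[OF that] by auto
  \<comment> \<open>The strict rows have coefficient 0, so the sum over the weak rows is already the
    full sum.\<close>
  have "(\<Sum>k\<in>{k\<in>R. is_LE (c k)}. \<kappa> k * rhs (c k)) = (\<Sum>k\<in>R. \<kappa> k * rhs (c k))"
    using \<open>finite R\<close> strict0 by (intro sum.mono_neutral_left) (auto, metis ineq.exhaust_disc)
  also have "\<dots> = 0"
    using sum0 by (simp only: tight cong: sum.cong)
  finally show False
    using alt strict0 by simp
qed

text \<open>Turns a certificate into an implication: some conjunct fails at \<open>z\<close>, but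
  the matrix rows and the hypotheses hold there, so the failing one is a negated conclusion.\<close>

lemma motzkin_infeasible:
  fixes C :: "'k::linordered_field mat"
  assumes "motzkin d C c C' c' H h G g"
    and "C \<in> carrier_mat (dim_vec c) d" "C' \<in> carrier_mat (dim_vec c') d"
    and "finite H" "\<And>a. a \<in> H \<Longrightarrow> lhs (h a) \<in> carrier_vec d"
    and "finite G" "\<And>b. b \<in> G \<Longrightarrow> lhs (g b) \<in> carrier_vec d"
    and z: "z \<in> polyhedron d C c C' c'"
    and hyps: "\<And>a. a \<in> H \<Longrightarrow> ineq_holds z (h a)"
  shows "\<exists>b\<in>G. \<not> ineq_holds z (g b)"
proof -
  have "\<exists>k\<in>conjuncts C C' H G. \<not> ineq_holds z (conjunct_ineq C c C' c' h g k)"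
  proof (rule motzkin_transform_infeasible)
    show "motzkin_transform d (conjuncts C C' H G) (conjunct_ineq C c C' c' h g)"
      using assms(1) by (simp add: motzkin_def)
    show "finite (conjuncts C C' H G)"
      using assms by (simp add: conjuncts_def)
    show "lhs (conjunct_ineq C c C' c' h g k) \<in> carrier_vec d" if "k \<in> conjuncts C C' H G" for k
      using assms that by (auto simp: conjuncts_def)
    show "z \<in> carrier_vec d"
      using z by (simp add: polyhedron_def)
  qed
  moreover have "row C r \<bullet> z \<le> c $ r" if "r < dim_row C" for r
    using z that assms(2) by (auto simp: polyhedron_def less_eq_vec_def)
  moreover have "row C' r \<bullet> z < c' $ r" if "r < dim_row C'" for r
    using z that assms(3) by (auto simp: polyhedron_def vec_less_def)
  ultimately show ?thesis
    using hyps by (force simp: conjuncts_def)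
qed

text \<open>The two halves of \<open>atom_vec\<close> pair with \<open>x\<close> and
  \<open>x'\<close> separately. What remains, the offsets \<open>t f\<close> with weight
  \<open>\<alpha> a f + \<beta> a f\<close> and the scalar unknowns, goes to the right-hand side
  with its sign changed.\<close>

lemma rel_holds_atom_vec:
  fixes s :: "'f \<Rightarrow> 'k::linordered_field vec"
  assumes "finite F" "\<And>f. f \<in> F \<Longrightarrow> s f \<in> carrier_vec n"
    and "x \<in> carrier_vec n" "x' \<in> carrier_vec n"
  shows "rel_holds (rel a) (atom_vec n F a s \<bullet> (x @\<^sub>v x')) (atom_rhs F D a t u) \<longleftrightarrow>
    atom_holds F D a s t u x x'"
proof -
  have carrier: "finsum_vec TYPE('k) n (\<lambda>f. w f \<cdot>\<^sub>v s f) F \<in> carrier_vec n" for w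
    using assms by (intro finsum_vec_closed) auto
  have prod: "finsum_vec TYPE('k) n (\<lambda>f. w f \<cdot>\<^sub>v s f) F \<bullet> y = (\<Sum>f\<in>F. w f * (s f \<bullet> y))"
    if "y \<in> carrier_vec n" for w y
    using assms that by (subst finsum_vec_scalar_prod) (auto intro!: sum.cong)
  have "atom_vec n F a s \<bullet> (x @\<^sub>v x') =
      (\<Sum>f\<in>F. \<alpha> a f * (s f \<bullet> x)) + (\<Sum>f\<in>F. \<beta> a f * (s f \<bullet> x'))"
    using assms(3,4) carrier by (simp add: atom_vec_def scalar_prod_append[of _ n _ n] prod)
  moreover have "(\<Sum>f\<in>F. \<alpha> a f * (s f \<bullet> x + t f) + \<beta> a f * (s f \<bullet> x' + t f)) =
      (\<Sum>f\<in>F. \<alpha> a f * (s f \<bullet> x)) + (\<Sum>f\<in>F. \<beta> a f * (s f \<bullet> x')) +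
      (\<Sum>f\<in>F. (\<alpha> a f + \<beta> a f) * t f)"
    by (simp add: algebra_simps sum.distrib)
  ultimately show ?thesis
    unfolding atom_holds_def atom_rhs_def by (simp only: rel_holds_add_0[symmetric] add.assoc)
qed

lemma atom_vec_carrier:
  fixes s :: "'f \<Rightarrow> 'k::linordered_field vec"
  assumes "\<And>f. f \<in> F \<Longrightarrow> s f \<in> carrier_vec n"
  shows "atom_vec n F a s \<in> carrier_vec (n + n)"
  using assms unfolding atom_vec_def
  by (intro append_carrier_vec finsum_vec_closed) auto

theorem theorem5p3:
  fixes n :: nat
    and N :: "'nu set" and B B' :: "'nu \<Rightarrow> 'k::linordered_field mat" and b b' :: "'nu \<Rightarrow> 'k vec"
    and M :: "'m set" and A A' :: "'m \<Rightarrow> 'k mat" and c c' :: "'m \<Rightarrow> 'k vec"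
    and F :: "'f set" and D :: "'d set"
    and I :: "'i set" and J :: "'i \<Rightarrow> 'j set"
    and T :: "'i \<Rightarrow> 'j \<Rightarrow> ('f, 'd, 'k) linear_atom"
    and L :: "'l set" and rl :: "'l \<Rightarrow> strictness"
  assumes field: "rational_or_real_closed TYPE('k)"
    and stem: "finite N"
      "\<And>\<nu>. \<nu> \<in> N \<Longrightarrow> B \<nu> \<in> carrier_mat (dim_vec (b \<nu>)) n"
      "\<And>\<nu>. \<nu> \<in> N \<Longrightarrow> B' \<nu> \<in> carrier_mat (dim_vec (b' \<nu>)) n"
    and loop: "finite M"
      "\<And>m. m \<in> M \<Longrightarrow> A m \<in> carrier_mat (dim_vec (c m)) (n + n)"
      "\<And>m. m \<in> M \<Longrightarrow> A' m \<in> carrier_mat (dim_vec (c' m)) (n + n)"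
    and template: "finite F" "finite D" "finite I" "\<And>i. i \<in> I \<Longrightarrow> finite (J i)"
      "ranking_function_template n F (cnf_template F D I J T)"
    and L: "finite L"
    and satisfiable: "\<exists>s t sF tF u.
      (\<forall>l'\<in>L \<times> I \<times> M. s l' \<in> carrier_vec n) \<and>
      (\<forall>f\<in>F. sF f \<in> carrier_vec n) \<and>
      II5 n N B b B' b' M I L rl s t \<and>
      IC5 n M A c A' c' I L rl s t \<and>
      TI5 n M A c A' c' F D I J T L rl s t sF tF u"
  shows "terminates (linear_lasso n N B b B' b' M A c A' c')"
proof -
  let ?P = "linear_lasso n N B b B' b' M A c A' c'"
  from satisfiable obtain s t sF tF u where
    s: "\<forall>l'\<in>L \<times> I \<times> M. s l' \<in> carrier_vec n"
    and sF: "\<forall>f\<in>F. sF f \<in> carrier_vec n"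
    and II: "II5 n N B b B' b' M I L rl s t"
    and IC: "IC5 n M A c A' c' I L rl s t"
    and TI: "TI5 n M A c A' c' F D I J T L rl s t sF tF u"
    by (elim exE conjE) (rule that)
  note s = s[rule_format] and sF = sF[rule_format]
  define \<psi> where "\<psi> l' x \<longleftrightarrow> rel_holds (rl (fst l')) (s l' \<bullet> x) (- t l')" for l' x
  have init: "\<psi> l' x" if l': "l' \<in> L \<times> I \<times> M" and x: "x \<in> fst ?P" for l' x
  proof -
    from x obtain \<nu> where \<nu>: "\<nu> \<in> N" "x \<in> polyhedron n (B \<nu>) (b \<nu>) (B' \<nu>) (b' \<nu>)"
      by (auto simp: linear_lasso_def)
    \<comment> \<open>The only negated conclusion here is that of \<psi>, so its failure is \<psi>
      at \<open>x\<close>.\<close>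
    from motzkin_infeasible[OF II[unfolded II5_def, rule_format, OF l' \<nu>(1)]
        stem(2,3)[OF \<nu>(1)] _ _ _ _ \<nu>(2)] s[OF l']
    show ?thesis by (simp add: \<psi>_def ineq_holds_neg_ineq)
  qed
  have step: "\<psi> l' x'" if l': "l' \<in> L \<times> I \<times> M" and x: "(x, x') \<in> snd ?P" "\<psi> l' x" for l' x x'
  proof -
    from x obtain m where m: "m \<in> M" "x @\<^sub>v x' \<in> polyhedron (n + n) (A m) (c m) (A' m) (c' m)"
      and carrier: "x \<in> carrier_vec n" "x' \<in> carrier_vec n"
      by (auto simp: linear_lasso_def)
    \<comment> \<open>The zero padding selects the half of the stacked vector at which the invariant
      is evaluated. The disjunct \<open>m\<close> of this transition may differ from the third
      component of \<open>l'\<close>.\<close>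
    have "(s l' @\<^sub>v 0\<^sub>v n) \<bullet> (x @\<^sub>v x') = s l' \<bullet> x" "(0\<^sub>v n @\<^sub>v s l') \<bullet> (x @\<^sub>v x') = s l' \<bullet> x'"
      using s[OF l'] carrier by (simp_all add: scalar_prod_append[of _ n _ n])
    moreover note motzkin_infeasible[OF IC[unfolded IC5_def, rule_format, OF l' m(1)]
        loop(2,3)[OF m(1)] _ _ _ _ m(2)]
    ultimately show ?thesis
      using s[OF l'] x(2) carrier by (simp add: \<psi>_def ineq_holds_neg_ineq ineq_holds_pos_ineq)
  qed
  have decrease: "cnf_template F D I J T sF tF u x x'"
    if x: "(x, x') \<in> snd ?P" and inv: "\<And>l'. l' \<in> L \<times> I \<times> M \<Longrightarrow> \<psi> l' x" for x x'
    unfolding cnf_template_def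
  proof
    fix i assume i: "i \<in> I"
    from x obtain m where m: "m \<in> M" "x @\<^sub>v x' \<in> polyhedron (n + n) (A m) (c m) (A' m) (c' m)"
      and carrier: "x \<in> carrier_vec n" "x' \<in> carrier_vec n"
      by (auto simp: linear_lasso_def)
    \<comment> \<open>The invariants used are those indexed by the current conjunct \<open>i\<close>
      and by the disjunct \<open>m\<close> that this transition satisfies. A failing negated atom is
      a true atom.\<close>
    have "\<exists>j\<in>J i. \<not> ineq_holds (x @\<^sub>v x')
        (neg_ineq (rel (T i j)) (atom_vec n F (T i j) sF) (atom_rhs F D (T i j) tF u))"
    proof (rule motzkin_infeasible[OF TI[unfolded TI5_def, rule_format, OF i m(1)]
          loop(2,3)[OF m(1)] _ _ _ _ m(2)])
      fix l assume "l \<in> L"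
      then have l': "(l, i, m) \<in> L \<times> I \<times> M" using i m(1) by simp
      show "lhs (pos_ineq (rl l) (s (l, i, m) @\<^sub>v 0\<^sub>v n) (- t (l, i, m))) \<in> carrier_vec (n + n)"
        using s[OF l'] by simp
      show "ineq_holds (x @\<^sub>v x') (pos_ineq (rl l) (s (l, i, m) @\<^sub>v 0\<^sub>v n) (- t (l, i, m)))"
        using s[OF l'] carrier inv[OF l']
        by (simp add: \<psi>_def ineq_holds_pos_ineq scalar_prod_append[of _ n _ n])
    qed (use L template(4)[OF i] sF in \<open>simp_all add: atom_vec_carrier\<close>)
    then show "\<exists>j\<in>J i. atom_holds F D (T i j) sF tF u x x'"
      using sF template(1) carrier by (simp add: ineq_holds_neg_ineq rel_holds_atom_vec)
  qed
  show ?thesis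
    unfolding terminates_def
  proof
    assume "\<exists>\<sigma>. infinite_execution ?P \<sigma>"
    then obtain \<sigma> where \<sigma>: "\<sigma> 0 \<in> fst ?P" "\<And>k. (\<sigma> k, \<sigma> (Suc k)) \<in> snd ?P"
      unfolding infinite_execution_def by blast
    have inv: "\<psi> l' (\<sigma> k)" if "l' \<in> L \<times> I \<times> M" for l' k
      by (induction k) (use init step \<sigma> that in blast)+
    \<comment> \<open>The loop of \<open>?P\<close> may contain transitions from states that violate
      the invariants, where \<open>decrease\<close> says nothing; along \<sigma> the invariants are
      available.\<close>
    define Q where "Q = ({\<sigma> 0}, range (\<lambda>k. (\<sigma> k, \<sigma> (Suc k))))"
    have "\<sigma> k \<in> carrier_vec n" for k
      using \<sigma>(2)[of k] by (auto simp: linear_lasso_def)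
    then have "lasso_program n Q"
      by (auto simp: lasso_program_def Q_def)
    moreover have "cnf_template F D I J T sF tF u x x'" if "(x, x') \<in> snd Q" for x x'
      using that decrease[OF \<sigma>(2) inv] by (auto simp: Q_def)
    ultimately have "terminates Q"
      using template(5) sF unfolding ranking_function_template_def by blast
    moreover have "infinite_execution Q \<sigma>"
      by (auto simp: infinite_execution_def Q_def)
    ultimately show False
      unfolding terminates_def by blast
  qed
qed

end
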